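(* Let $S$ and $\Omega$ be Polish spaces, let $\mathbf r$ be a nonzero finite measure on $\Omega$ with total mass $|\mathbf r|:=\mathbf r(\Omega)$, and let $\gamma:\Omega\times S^{\mathbb N_+}\to S$ be measurable. Assume that there exists a measurable function $\kappa:\Omega\to\mathbb N$ such that for all $\omega\in\Omega$ the value $\gamma[\omega](x_1,x_2,\ldots)=\gamma[\omega](x_1,\ldots,x_{\kappa(\omega)})$ depends only on the first $\kappa(\omega)$ coordinates of $x\in S^{\mathbb N_+}$, and such that $\int_\Omega \mathbf r(\mathrm d\omega)\,\kappa(\omega)<\infty$. Then for each initial state $\mu_0\in\mathcal P(S)$ the mean-field equation $$\tfrac{\partial}{\partial t}\mu_t=|\mathbf r|\{T(\mu_t)-\mu_t\}\qquad(t\ge 0)$$ has a unique solution $(\mu_t)_{t\ge 0}$.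
   Context: $\mathbb N=\{0,1,2,\ldots\}$, $\mathbb N_+=\{1,2,\ldots\}$; $\mathcal P(S)$ is the set of Borel probability measures on $S$; $\langle\mu,\phi\rangle:=\int\phi\,\mathrm d\mu$. For $\mu\in\mathcal P(S)$, $T(\mu)\in\mathcal P(S)$ is the law of $\gamma[\boldsymbol\omega](X_1,X_2,\ldots)$, where $\boldsymbol\omega$ has law $|\mathbf r|^{-1}\mathbf r$ and $(X_i)_{i\ge1}$ are i.i.d. with law $\mu$, independent of $\boldsymbol\omega$. A family $(\mu_t)_{t\ge 0}$ in $\mathcal P(S)$ solves the mean-field equation if for each bounded measurable $\phi:S\to\mathbb R$ the function $t\mapsto\langle\mu_t,\phi\rangle$ is continuously differentiable and $\frac{\partial}{\partial t}\langle\mu_t,\phi\rangle=|\mathbf r|\{\langle T(\mu_t),\phi\rangle-\langle\mu_t,\phi\rangle\}$ for all $t\ge 0$. *)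

theory Defs
  imports "HOL-Probability.Probability"
begin

text \<open>
  Conventions: \<open>\<P>(S)\<close> is \<^term>\<open>space (prob_algebra borel)\<close>, and sequences in \<open>S\<close> indexed by the
  positive integers are functions on \<^typ>\<open>nat\<close> with the index shifted by one, so that the
  coordinates \<open>x\<^sub>1, \<dots>, x\<^sub>k\<close> are \<open>x 0, \<dots>, x (k - 1)\<close>.
\<close>

definition total_mass :: "'w measure \<Rightarrow> real" where
  "total_mass r = measure r (space r)"

definition normalize_measure :: "'w measure \<Rightarrow> 'w measure" where
  "normalize_measure r = scale_measure (inverse (emeasure r (space r))) r"

text \<open>The product measure is the joint law of \<open>\<omega>\<close> and the independent i.i.d. sequence \<open>(X\<^sub>i)\<close>.\<close>

definition mf_map ::
  "'w measure \<Rightarrow> ('w \<Rightarrow> (nat \<Rightarrow> 's) \<Rightarrow> 's) \<Rightarrow> 's::topological_space measure \<Rightarrow> 's measure" where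
  "mf_map r \<gamma> \<mu> =
     distr (normalize_measure r \<Otimes>\<^sub>M (\<Pi>\<^sub>M i\<in>UNIV. \<mu>)) borel (\<lambda>(\<omega>, x). \<gamma> \<omega> x)"

text \<open>
  A family \<open>(\<mu>\<^sub>t)\<close> with \<open>t \<ge> 0\<close> is a function on \<open>{0..}\<close>, made extensional (\<^term>\<open>undefined\<close> at
  negative times) so that equality of functions is equality of families. The derivative at
  \<open>t = 0\<close> is one-sided.
\<close>

definition mean_field_solution ::
  "'w measure \<Rightarrow> ('w \<Rightarrow> (nat \<Rightarrow> 's) \<Rightarrow> 's) \<Rightarrow> (real \<Rightarrow> 's::topological_space measure) \<Rightarrow> bool" where
  "mean_field_solution r \<gamma> \<mu> \<longleftrightarrow>
     \<mu> \<in> {0..} \<rightarrow>\<^sub>E space (prob_algebra borel) \<and>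
     (\<forall>\<phi> :: 's \<Rightarrow> real. \<phi> \<in> borel_measurable borel \<and> bounded (range \<phi>) \<longrightarrow>
       (\<exists>D. continuous_on {0..} D \<and>
         (\<forall>t\<ge>0. ((\<lambda>s. \<integral>x. \<phi> x \<partial>\<mu> s) has_real_derivative D t) (at t within {0..}) \<and>
           D t = total_mass r * ((\<integral>x. \<phi> x \<partial>mf_map r \<gamma> (\<mu> t)) - (\<integral>x. \<phi> x \<partial>\<mu> t)))))"

end

theory Submission
  imports Defs
begin

text \<open>
  Exchanging the i.i.d. inputs one at a time shows that \<open>T\<close> is Lipschitz for the total variation
  norm, with constant \<open>L\<close> the mean of \<open>\<kappa>\<close>. For a given Lipschitz curve \<open>N\<close>, the linear equation
  \<open>M' = c (T N - M)\<close> with \<open>c = |r|\<close> is solved by the law of a state drawn from \<open>T (N (t - \<tau>))\<close> if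
  \<open>\<tau> \<le> t\<close> and from the initial law otherwise, \<open>\<tau>\<close> being exponential with rate \<open>c\<close>. In the weighted
  distance \<open>sup\<^sub>t exp (- c L t) \<parallel>M t - M' t\<parallel>\<close> the map from \<open>N\<close> to \<open>M\<close> contracts by \<open>L / (L + 1)\<close>, on
  all of \<open>[0, \<infinity>)\<close> at once; so Picard iteration gives existence, and uniqueness as well.
\<close>

subsection \<open>Total variation\<close>

text \<open>Test functions are merely bounded and measurable, and \<open>\<gamma>\<close> is merely
  measurable, so weak convergence gives no control of T and distances have to be of total variation
  type. Only differences of expectations are compared: no signed measure and no supremum is formed,
  which turns each estimate on measures into a scalar one, for one test function at one time. The
  price is that completeness has to be built from limits on sets.

  The constant L may exceed 1, so T itself need not contract. What contracts is the evolution: the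
  difference u of two solutions with the same start is the integral over s in [0, t] of c
  exp(-c(t-s)) w(s), with w the difference of the inputs. If |w(s)| is at most L d exp(cLs), then
  |u(t)| is at most L/(L+1) d exp(cLt): the numerator comes from T, the denominator from adding the
  decay rate c to the growth rate cL of the weight. The factor is below 1 for every L, and no short
  time intervals have to be glued.\<close>

lemma prob_algebraD:
  assumes "M \<in> space (prob_algebra N)"
  shows "prob_space M" "sets M = sets N"
  using assms by (auto simp: space_prob_algebra)

text \<open>Says that \<open>e\<close> dominates the norm of M - N as a functional on bounded
  measurable functions. In this normalization two probability measures are at distance at most 2,
  not 1. As a relation it lets error terms be chained and sent to a limit without naming the least
  bound.\<close>

definition tv_bound :: "real \<Rightarrow> 'a measure \<Rightarrow> 'a measure \<Rightarrow> bool" where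
  "tv_bound e M N \<longleftrightarrow> (\<forall>f B. f \<in> borel_measurable M \<longrightarrow> (\<forall>x. \<bar>f x\<bar> \<le> B) \<longrightarrow>
     \<bar>(\<integral>x. f x \<partial>M) - (\<integral>x. f x \<partial>N)\<bar> \<le> B * e)"

lemma tv_boundD:
  fixes f :: "'a \<Rightarrow> real"
  assumes "tv_bound e M N" "f \<in> borel_measurable M" "\<And>x. \<bar>f x\<bar> \<le> B"
  shows "\<bar>(\<integral>x. f x \<partial>M) - (\<integral>x. f x \<partial>N)\<bar> \<le> B * e"
  using assms unfolding tv_bound_def by blast

lemma (in prob_space) integrable_bounded:
  fixes f :: "'a \<Rightarrow> real"
  assumes "f \<in> borel_measurable M" "\<And>x. \<bar>f x\<bar> \<le> B"
  shows "integrable M f"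
  by (rule integrable_const_bound[where B = B]) (use assms in auto)

lemma (in prob_space) abs_expectation_le:
  fixes f :: "'a \<Rightarrow> real"
  assumes "\<And>x. \<bar>f x\<bar> \<le> B"
  shows "\<bar>\<integral>x. f x \<partial>M\<bar> \<le> B"
proof (cases "integrable M f")
  case True
  have "\<bar>\<integral>x. f x \<partial>M\<bar> \<le> (\<integral>x. \<bar>f x\<bar> \<partial>M)"
    by (rule integral_abs_bound)
  also have "\<dots> \<le> B"
    by (rule integral_le_const) (use True assms in auto)
  finally show ?thesis .
next
  case False
  \<comment> \<open>A non-integrable function has integral 0 by default, so it remains to see that 0
    is within the bound.\<close>
  have "0 \<le> B" using assms[of undefined] by linarith
  with False show ?thesis by (simp add: not_integrable_integral_eq)
qed

lemma tv_bound_triangle: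
  assumes "tv_bound a M N" "tv_bound b N P" "sets M = sets N"
  shows "tv_bound (a + b) M P"
  unfolding tv_bound_def
proof (intro allI impI)
  fix f :: "'a \<Rightarrow> real" and B assume f: "f \<in> borel_measurable M" "\<forall>x. \<bar>f x\<bar> \<le> B"
  have "f \<in> borel_measurable N" using f(1) assms(3) by (simp cong: measurable_cong_sets)
  with tv_boundD[OF assms(1) f(1)] tv_boundD[OF assms(2), of f B] f(2)
  show "\<bar>(\<integral>x. f x \<partial>M) - (\<integral>x. f x \<partial>P)\<bar> \<le> B * (a + b)"
    by (force simp: distrib_left)
qed

lemma tv_bound_sym:
  assumes "tv_bound a M N" "sets M = sets N"
  shows "tv_bound a N M"
  using assms unfolding tv_bound_def
  by (simp add: abs_minus_commute cong: measurable_cong_sets)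

lemma tv_bound_2:
  assumes "prob_space M" "prob_space N"
  shows "tv_bound 2 M N"
  unfolding tv_bound_def
proof (intro allI impI)
  fix f :: "'a \<Rightarrow> real" and B assume f: "\<forall>x. \<bar>f x\<bar> \<le> B"
  have "\<bar>\<integral>x. f x \<partial>M\<bar> \<le> B" "\<bar>\<integral>x. f x \<partial>N\<bar> \<le> B"
    using f assms prob_space.abs_expectation_le by blast+
  then show "\<bar>(\<integral>x. f x \<partial>M) - (\<integral>x. f x \<partial>N)\<bar> \<le> B * 2"
    by linarith
qed

lemma tv_bound_mono:
  assumes "tv_bound a M N" "a \<le> b"
  shows "tv_bound b M N"
  unfolding tv_bound_def
proof (intro allI impI)
  fix f :: "'a \<Rightarrow> real" and B assume f: "f \<in> borel_measurable M" "\<forall>x. \<bar>f x\<bar> \<le> B"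
  have "0 \<le> B" using f(2) abs_ge_zero order_trans by blast
  with assms(2) have "B * a \<le> B * b" by (simp add: mult_left_mono)
  with tv_boundD[OF assms(1) f(1)] f(2)
  show "\<bar>(\<integral>x. f x \<partial>M) - (\<integral>x. f x \<partial>N)\<bar> \<le> B * b" by force
qed

lemma tv_bound_LIMSEQ:
  assumes "\<And>n. tv_bound (e n) M N" "e \<longlonglongrightarrow> d"
  shows "tv_bound d M N"
  unfolding tv_bound_def
proof (intro allI impI)
  fix f :: "'a \<Rightarrow> real" and B assume f: "f \<in> borel_measurable M" "\<forall>x. \<bar>f x\<bar> \<le> B"
  have "\<bar>(\<integral>x. f x \<partial>M) - (\<integral>x. f x \<partial>N)\<bar> \<le> B * e n" for n
    using tv_boundD[OF assms(1) f(1)] f(2) by blast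
  moreover have "(\<lambda>n. B * e n) \<longlonglongrightarrow> B * d" by (intro tendsto_intros assms)
  ultimately show "\<bar>(\<integral>x. f x \<partial>M) - (\<integral>x. f x \<partial>N)\<bar> \<le> B * d"
    by (meson LIMSEQ_le_const)
qed

lemma tv_bound_0_eq:
  assumes "tv_bound 0 M N" "prob_space M" "prob_space N" "sets M = sets N"
  shows "M = N"
proof (rule measure_eqI)
  fix A assume A: "A \<in> sets M"
  interpret M: prob_space M by fact
  interpret N: prob_space N by fact
  have "\<bar>(\<integral>x. indicat_real A x \<partial>M) - (\<integral>x. indicat_real A x \<partial>N)\<bar> \<le> 1 * 0"
    using A by (intro tv_boundD[OF assms(1)]) (auto simp: indicator_def)
  then have "measure M A = measure N A"
    using A assms(4) by simp
  then show "emeasure M A = emeasure N A"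
    by (simp add: M.emeasure_eq_measure N.emeasure_eq_measure)
qed fact

section \<open>Setwise limits and completeness in total variation\<close>

text \<open>A level \<open>u\<close> drawn uniformly from [-B, B] falls below \<open>f x\<close>
  with probability (f x + B) / (2 B); averaging over x and exchanging the two integrals gives the
  identity. It expresses an expectation through measures of sets alone.\<close>

lemma (in prob_space) layer_cake_expectation:
  fixes f :: "'a \<Rightarrow> real"
  assumes [measurable]: "f \<in> borel_measurable M" and f: "\<And>x. \<bar>f x\<bar> \<le> B" and "0 < B"
  shows "((\<integral>x. f x \<partial>M) + B) / (2 * B) =
    (\<integral>u. measure M {x \<in> space M. u < f x} \<partial>uniform_measure lborel {-B..B})"
proof -
  define U where "U = uniform_measure lborel {-B..B}"
  have [measurable_cong]: "sets U = sets borel" by (simp add: U_def)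
  interpret U: prob_space U
    unfolding U_def using \<open>0 < B\<close> by (intro prob_space_uniform_measure) auto
  interpret MU: pair_prob_space M U ..
  have int: "integrable M f" by (rule integrable_bounded[OF _ f]) measurable
  have inner: "(\<integral>u. (if u < f x then 1 else 0 :: real) \<partial>U) = (f x + B) / (2 * B)" for x
  proof -
    have "{-B..B} \<inter> {..<f x} = {-B..<f x}" using f[of x] by (auto simp: abs_le_iff)
    then have "measure U {..<f x} = (f x + B) / (2 * B)"
      unfolding U_def using f[of x] \<open>0 < B\<close> by (subst measure_uniform_measure) (auto simp: abs_le_iff)
    moreover have "(\<integral>u. indicat_real {..<f x} u \<partial>U) = measure U {..<f x}"
      by (simp add: U_def)
    moreover have "indicat_real {..<f x} = (\<lambda>u. if u < f x then 1 else 0)"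
      by (auto simp: indicator_def)
    ultimately show ?thesis by simp
  qed
  have "((\<integral>x. f x \<partial>M) + B) / (2 * B) = (\<integral>x. (f x + B) / (2 * B) \<partial>M)"
    using int by (simp add: prob_space)
  also have "\<dots> = (\<integral>x. (\<integral>u. (if u < f x then 1 else 0 :: real) \<partial>U) \<partial>M)"
    by (simp add: inner)
  also have "\<dots> = (\<integral>u. (\<integral>x. (if u < f x then 1 else 0 :: real) \<partial>M) \<partial>U)"
    by (rule MU.Fubini_integral[symmetric])
       (auto intro!: MU.integrable_bounded[where B = 1] split: if_splits)
  also have "\<dots> = (\<integral>u. measure M {x \<in> space M. u < f x} \<partial>U)"
  proof (rule Bochner_Integration.integral_cong)
    fix u
    have "(\<integral>x. (if u < f x then 1 else 0 :: real) \<partial>M) = (\<integral>x. indicat_real {x \<in> space M. u < f x} x \<partial>M)"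
      by (rule Bochner_Integration.integral_cong) (auto simp: indicator_def)
    then show "(\<integral>x. (if u < f x then 1 else 0 :: real) \<partial>M) = measure M {x \<in> space M. u < f x}"
      by simp
  qed simp
  finally show ?thesis by (simp add: U_def)
qed

text \<open>By the layer cake formula both sides are averages over a level \<open>u\<close> of the
  measure of the set where \<open>f\<close> exceeds \<open>u\<close>. These measures converge for
  each \<open>u\<close> and are at most 1, so dominated convergence applies, with a measure in
  \<open>u\<close> that does not depend on \<open>n\<close>.\<close>

lemma expectation_LIMSEQ_setwise:
  fixes f :: "'a \<Rightarrow> real"
  assumes "\<And>n. prob_space (P n)" "prob_space M" and sets: "\<And>n. sets (P n) = sets M"
    and lim: "\<And>A. A \<in> sets M \<Longrightarrow> (\<lambda>n. measure (P n) A) \<longlonglongrightarrow> measure M A"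
    and [measurable]: "f \<in> borel_measurable M" and f: "\<And>x. \<bar>f x\<bar> \<le> B"
  shows "(\<lambda>n. \<integral>x. f x \<partial>P n) \<longlonglongrightarrow> (\<integral>x. f x \<partial>M)"
proof -
  have "0 \<le> B" using f[of undefined] by linarith
  \<comment> \<open>The layer cake formula divides by twice the bound, and \<open>B\<close> may be
    0.\<close>
  define C where "C = B + 1"
  have C: "0 < C" "\<And>x. \<bar>f x\<bar> \<le> C" using \<open>0 \<le> B\<close> f by (auto simp: C_def intro: add_increasing2)
  define U where "U = uniform_measure lborel {-C..C}"
  have [measurable_cong]: "sets U = sets borel" by (simp add: U_def)
  interpret U: prob_space U
    unfolding U_def using C by (intro prob_space_uniform_measure) auto
  interpret M: prob_space M by fact
  have space: "space (P n) = space M" for n using sets sets_eq_imp_space_eq by blast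
  \<comment> \<open>As a function of \<open>u\<close> this is a parameter integral of a jointly
    measurable function.\<close>
  have meas: "(\<lambda>u. measure N {x \<in> space N. u < f x}) \<in> borel_measurable borel"
    if "prob_space N" "sets N = sets M" for N
  proof -
    interpret N: prob_space N by fact
    have [measurable]: "f \<in> borel_measurable N"
      using that by (simp cong: measurable_cong_sets)
    have "(\<lambda>u. \<integral>x. (if u < f x then 1 else 0 :: real) \<partial>N) \<in> borel_measurable borel"
      by measurable
    also have "(\<lambda>u. \<integral>x. (if u < f x then 1 else 0 :: real) \<partial>N) = (\<lambda>u. measure N {x \<in> space N. u < f x})"
    proof
      fix u
      have "(\<integral>x. (if u < f x then 1 else 0 :: real) \<partial>N) = (\<integral>x. indicat_real {x \<in> space N. u < f x} x \<partial>N)"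
        by (rule Bochner_Integration.integral_cong) (auto simp: indicator_def)
      then show "(\<integral>x. (if u < f x then 1 else 0 :: real) \<partial>N) = measure N {x \<in> space N. u < f x}"
        by simp
    qed
    finally show ?thesis .
  qed
  have "(\<lambda>n. \<integral>u. measure (P n) {x \<in> space (P n). u < f x} \<partial>U) \<longlonglongrightarrow>
      (\<integral>u. measure M {x \<in> space M. u < f x} \<partial>U)"
  proof (rule integral_dominated_convergence[where w = "\<lambda>_. 1"])
    show "AE u in U. (\<lambda>n. measure (P n) {x \<in> space (P n). u < f x}) \<longlonglongrightarrow> measure M {x \<in> space M. u < f x}"
      unfolding space by (intro AE_I2 lim) measurable
    show "(\<lambda>u. measure M {x \<in> space M. u < f x}) \<in> borel_measurable U"
      using meas[OF assms(2) refl] by (simp add: U_def)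
    show "(\<lambda>u. measure (P n) {x \<in> space (P n). u < f x}) \<in> borel_measurable U" for n
      using meas[OF assms(1) sets] by (simp add: U_def)
  qed (use assms(1) prob_space.prob_le_1 in auto)
  also have "(\<lambda>n. \<integral>u. measure (P n) {x \<in> space (P n). u < f x} \<partial>U) =
      (\<lambda>n. ((\<integral>x. f x \<partial>P n) + C) / (2 * C))"
    unfolding U_def using C assms(1)
    by (intro ext prob_space.layer_cake_expectation[symmetric]) (simp_all add: sets cong: measurable_cong_sets)
  also have "(\<integral>u. measure M {x \<in> space M. u < f x} \<partial>U) = ((\<integral>x. f x \<partial>M) + C) / (2 * C)"
    unfolding U_def using C by (intro M.layer_cake_expectation[symmetric]) auto
  finally have "(\<lambda>n. ((\<integral>x. f x \<partial>P n) + C) / (2 * C)) \<longlonglongrightarrow> ((\<integral>x. f x \<partial>M) + C) / (2 * C)" .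
  from tendsto_mult_left[OF this, of "2 * C"]
  have "(\<lambda>n. (\<integral>x. f x \<partial>P n) + C) \<longlonglongrightarrow> (\<integral>x. f x \<partial>M) + C" using C by simp
  from tendsto_diff[OF this tendsto_const[of C]] show ?thesis by simp
qed

lemma tv_bound_measure:
  assumes "tv_bound e M N" "A \<in> sets M" "sets M = sets N"
  shows "\<bar>measure M A - measure N A\<bar> \<le> e"
proof -
  have "\<bar>(\<integral>x. indicat_real A x \<partial>M) - (\<integral>x. indicat_real A x \<partial>N)\<bar> \<le> 1 * e"
    using assms(2) by (intro tv_boundD[OF assms(1)]) (auto simp: indicator_def)
  then show ?thesis using assms sets.sets_into_space by (simp add: Int_absorb2)
qed

text \<open>The Cauchy bound is uniform over all sets. So the setwise limit \<open>l\<close> exists,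
  stays within \<open>e n\<close> of \<open>P n\<close> on every set, and is a measure; the bound on
  test functions survives because expectations converge along with the sets.\<close>

lemma tv_Cauchy_limit:
  assumes P: "\<And>n. P n \<in> space (prob_algebra Q)"
    and cauchy: "\<And>n m. n \<le> m \<Longrightarrow> tv_bound (e n) (P n) (P m)"
    and e: "e \<longlonglongrightarrow> 0"
  shows "\<exists>M \<in> space (prob_algebra Q). \<forall>n. tv_bound (e n) (P n) M"
proof -
  have sets: "sets (P n) = sets Q" and prob: "prob_space (P n)" for n
    using prob_algebraD[OF P] by auto
  have space: "space (P n) = space Q" for n using sets sets_eq_imp_space_eq by blast
  have diff: "\<bar>measure (P n) A - measure (P m) A\<bar> \<le> e n" if "n \<le> m" "A \<in> sets Q" for n m A
    using tv_bound_measure[OF cauchy[OF that(1)]] that sets by simp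
  have "Cauchy (\<lambda>n. measure (P n) A)" if A: "A \<in> sets Q" for A
  proof (rule metric_CauchyI)
    fix d :: real assume "0 < d"
    with e obtain N where N: "\<And>n. N \<le> n \<Longrightarrow> e n < d"
      by (metis order_tendstoD(2) eventually_sequentially)
    have "dist (measure (P n) A) (measure (P m) A) < d" if "N \<le> n" "N \<le> m" for n m
      using diff[OF _ A, of n m] diff[OF _ A, of m n] N that
      by (cases "n \<le> m") (force simp: dist_real_def abs_minus_commute)+
    then show "\<exists>N. \<forall>n\<ge>N. \<forall>m\<ge>N. dist (measure (P n) A) (measure (P m) A) < d" by blast
  qed
  then have "\<exists>l. (\<lambda>n. measure (P n) A) \<longlonglongrightarrow> l" if "A \<in> sets Q" for A
    using that by (simp add: Cauchy_convergent_iff convergent_def)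
  then obtain l where l: "\<And>A. A \<in> sets Q \<Longrightarrow> (\<lambda>n. measure (P n) A) \<longlonglongrightarrow> l A"
    by metis
  have l_diff: "\<bar>measure (P n) A - l A\<bar> \<le> e n" if A: "A \<in> sets Q" for n A
  proof (rule LIMSEQ_le_const2)
    show "(\<lambda>m. \<bar>measure (P n) A - measure (P m) A\<bar>) \<longlonglongrightarrow> \<bar>measure (P n) A - l A\<bar>"
      by (intro tendsto_intros l A)
    show "\<exists>N. \<forall>m\<ge>N. \<bar>measure (P n) A - measure (P m) A\<bar> \<le> e n" using diff A by blast
  qed
  have l_nonneg: "0 \<le> l A" if "A \<in> sets Q" for A
    by (rule LIMSEQ_le_const[OF l[OF that]]) auto
  define M where "M = measure_of (space Q) (sets Q) (\<lambda>A. ennreal (l A))"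
  have sets_M: "sets M = sets Q" and space_M: "space M = space Q"
    by (simp_all add: M_def sets.space_closed)
  have "countably_additive (sets Q) (\<lambda>A. ennreal (l A))" "positive (sets Q) (\<lambda>A. ennreal (l A))"
  proof -
    have "(\<lambda>n. measure (P n) {}) \<longlonglongrightarrow> l {}" by (intro l) simp
    then have "l {} = 0" by (simp add: LIMSEQ_const_iff)
    then show pos: "positive (sets Q) (\<lambda>A. ennreal (l A))" by (simp add: positive_def)
    have add: "additive (sets Q) (\<lambda>A. ennreal (l A))"
      unfolding additive_def
    proof (intro ballI impI)
      fix A B assume AB: "A \<in> sets Q" "B \<in> sets Q" "A \<inter> B = {}"
      have "measure (P n) (A \<union> B) = measure (P n) A + measure (P n) B" for n
        using AB sets finite_measure.finite_measure_Union[OF prob_space.finite_measure[OF prob]] by simp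
      then have "(\<lambda>n. measure (P n) A + measure (P n) B) \<longlonglongrightarrow> l (A \<union> B)"
        using l[of "A \<union> B"] AB by simp
      moreover have "(\<lambda>n. measure (P n) A + measure (P n) B) \<longlonglongrightarrow> l A + l B"
        by (intro tendsto_intros l AB)
      ultimately have "l (A \<union> B) = l A + l B" by (rule LIMSEQ_unique)
      then show "ennreal (l (A \<union> B)) = ennreal (l A) + ennreal (l B)"
        using AB by (simp add: l_nonneg)
    qed
    show "countably_additive (sets Q) (\<lambda>A. ennreal (l A))"
    proof (rule sets.empty_continuous_imp_countably_additive[OF pos add])
      fix A :: "nat \<Rightarrow> _" assume A: "range A \<subseteq> sets Q" "decseq A" "(\<Inter>i. A i) = {}"
      \<comment> \<open>Continuity at the empty set is borrowed from one fixed \<open>P n\<close>: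
        with \<open>e n < d / 2\<close> the error is below d/2 for all \<open>A i\<close> at once,
        and \<open>P n\<close> of \<open>A i\<close> falls below d/2 for large i.\<close>
      have "(\<lambda>i. l (A i)) \<longlonglongrightarrow> 0"
      proof (rule LIMSEQ_I)
        fix d :: real assume "0 < d"
        with e obtain n where n: "e n < d / 2"
          by (metis order_tendstoD(2) eventually_sequentially half_gt_zero order_refl)
        have "(\<lambda>i. measure (P n) (A i)) \<longlonglongrightarrow> measure (P n) (\<Inter>i. A i)"
          using A sets by (intro finite_measure.finite_Lim_measure_decseq prob_space.finite_measure prob) auto
        with A(3) have "(\<lambda>i. measure (P n) (A i)) \<longlonglongrightarrow> 0" by simp
        then have "\<forall>\<^sub>F i in sequentially. measure (P n) (A i) < d / 2"
          using \<open>0 < d\<close> by (intro order_tendstoD(2)) auto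
        then obtain N where N: "\<And>i. N \<le> i \<Longrightarrow> measure (P n) (A i) < d / 2"
          by (auto simp: eventually_sequentially)
        have "norm (l (A i) - 0) < d" if "N \<le> i" for i
        proof -
          have "A i \<in> sets Q" using A by auto
          with l_diff[OF this, of n] l_nonneg[OF this] N[OF that] n show ?thesis by simp
        qed
        then show "\<exists>N. \<forall>i\<ge>N. norm (l (A i) - 0) < d" by blast
      qed
      then show "(\<lambda>i. ennreal (l (A i))) \<longlonglongrightarrow> 0"
        using tendsto_ennrealI by fastforce
    qed simp
  qed
  then have em: "emeasure M A = ennreal (l A)" if "A \<in> sets Q" for A
    unfolding M_def using that by (intro emeasure_measure_of_sigma sets.sigma_algebra_axioms)
  have "(\<lambda>n. measure (P n) (space Q)) \<longlonglongrightarrow> l (space Q)" by (intro l) simp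
  moreover have "measure (P n) (space Q) = 1" for n
    using prob_space.prob_space[OF prob, of n] space by simp
  ultimately have "l (space Q) = 1" by (simp add: LIMSEQ_const_iff)
  then have M: "prob_space M"
    by (intro prob_spaceI) (simp add: space_M em)
  have me: "measure M A = l A" if "A \<in> sets Q" for A
    using em[OF that] l_nonneg[OF that] by (simp add: measure_def)
  have "tv_bound (e n) (P n) M" for n
    unfolding tv_bound_def
  proof (intro allI impI)
    fix f :: "_ \<Rightarrow> real" and B assume f: "f \<in> borel_measurable (P n)" "\<forall>x. \<bar>f x\<bar> \<le> B"
    have lim: "(\<lambda>m. \<integral>x. f x \<partial>P m) \<longlonglongrightarrow> (\<integral>x. f x \<partial>M)"
      by (rule expectation_LIMSEQ_setwise[where B = B])
         (use f prob M sets sets_M l me in \<open>auto cong: measurable_cong_sets\<close>)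
    show "\<bar>(\<integral>x. f x \<partial>P n) - (\<integral>x. f x \<partial>M)\<bar> \<le> B * e n"
    proof (rule LIMSEQ_le_const2)
      show "(\<lambda>m. \<bar>(\<integral>x. f x \<partial>P n) - (\<integral>x. f x \<partial>P m)\<bar>) \<longlonglongrightarrow> \<bar>(\<integral>x. f x \<partial>P n) - (\<integral>x. f x \<partial>M)\<bar>"
        by (intro tendsto_intros lim)
      show "\<exists>N. \<forall>m\<ge>N. \<bar>(\<integral>x. f x \<partial>P n) - (\<integral>x. f x \<partial>P m)\<bar> \<le> B * e n"
        using tv_boundD[OF cauchy f(1)] f(2) by blast
    qed
  qed
  then show ?thesis using M sets_M by (auto simp: space_prob_algebra)
qed

subsection \<open>Product measures\<close>

text \<open>An i.i.d. sequence is a first draw followed by an independent copy of the sequence.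
  Splitting off the first coordinate is what makes induction on the number of relevant coordinates
  possible.\<close>

lemma (in sequence_space) integral_PiM_iter:
  fixes g :: "(nat \<Rightarrow> 'a) \<Rightarrow> real"
  assumes [measurable]: "g \<in> borel_measurable S" and "\<And>x. \<bar>g x\<bar> \<le> B"
  shows "(\<integral>x. g x \<partial>S) = (\<integral>s. (\<integral>x. g (case_nat s x) \<partial>S) \<partial>M)"
proof -
  interpret MS: pair_prob_space M S ..
  have "(\<integral>x. g x \<partial>S) = (\<integral>x. g x \<partial>distr (M \<Otimes>\<^sub>M S) S (\<lambda>(s, \<omega>). case_nat s \<omega>))"
    by (simp add: PiM_iter)
  also have "\<dots> = (\<integral>p. g ((\<lambda>(s, \<omega>). case_nat s \<omega>) p) \<partial>(M \<Otimes>\<^sub>M S))"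
    by (rule integral_distr) measurable
  also have "\<dots> = (\<integral>s. (\<integral>x. g (case_nat s x) \<partial>S) \<partial>M)"
    by (subst MS.integral_fst'[symmetric])
       (auto intro!: MS.integrable_bounded[where B = B] assms(2) split: prod.split)
  finally show ?thesis .
qed

lemma sequence_space_prob_space: "prob_space M \<Longrightarrow> sequence_space M"
  unfolding sequence_space_def product_prob_space_def product_prob_space_axioms_def
    product_sigma_finite_def
  by (auto intro: prob_space_imp_sigma_finite)

text \<open>The coordinates are exchanged one at a time, each at cost \<open>B * e\<close>.\<close>

lemma tv_bound_PiM_prefix:
  fixes g :: "(nat \<Rightarrow> 'a) \<Rightarrow> real"
  assumes tv: "tv_bound e M N" and prob: "prob_space M" "prob_space N"
    and sets: "sets M = sets Q" "sets N = sets Q"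
    and "g \<in> borel_measurable (\<Pi>\<^sub>M i\<in>UNIV. Q)" "\<And>x. \<bar>g x\<bar> \<le> B"
    and "\<And>x y. (\<And>i. i < k \<Longrightarrow> x i = y i) \<Longrightarrow> g x = g y"
  shows "\<bar>(\<integral>x. g x \<partial>(\<Pi>\<^sub>M i\<in>UNIV. M)) - (\<integral>x. g x \<partial>(\<Pi>\<^sub>M i\<in>UNIV. N))\<bar> \<le> B * (real k * e)"
  using assms(6-8)
proof (induction k arbitrary: g)
  interpret M: sequence_space M by (rule sequence_space_prob_space) fact
  interpret N: sequence_space N by (rule sequence_space_prob_space) fact
  case 0
  then obtain a where "g = (\<lambda>_. a)" by (metis less_nat_zero_code)
  then show ?case using M.P.prob_space N.P.prob_space by simp
next
  interpret M: sequence_space M by (rule sequence_space_prob_space) fact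
  interpret N: sequence_space N by (rule sequence_space_prob_space) fact
  case (Suc k)
  note [measurable_cong] = sets
  have setsS: "sets M.S = sets (\<Pi>\<^sub>M i\<in>UNIV. Q)" "sets N.S = sets (\<Pi>\<^sub>M i\<in>UNIV. Q)"
    using sets by (auto intro!: sets_PiM_cong)
  note [measurable] = Suc.prems(1)
  have gM [measurable]: "g \<in> borel_measurable M.S" and gN [measurable]: "g \<in> borel_measurable N.S"
    using Suc.prems(1) setsS by (simp_all cong: measurable_cong_sets)
  \<comment> \<open>The hybrid between the two products takes the first coordinate from
    \<open>M\<close> and the tail from \<open>N\<close>: its expectation is the integral of
    \<open>h\<close> over \<open>M\<close>. Replacing the tail (\<open>h'\<close> by
    \<open>h\<close>) is the induction hypothesis, replacing the first coordinate is the assumption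
    on \<open>M\<close> and \<open>N\<close>.\<close>
  define h where "h s = (\<integral>x. g (case_nat s x) \<partial>N.S)" for s
  define h' where "h' s = (\<integral>x. g (case_nat s x) \<partial>M.S)" for s
  have h [measurable]: "h \<in> borel_measurable M"
    unfolding h_def by measurable
  have h' [measurable]: "h' \<in> borel_measurable M"
    unfolding h'_def by measurable
  have hB: "\<bar>h s\<bar> \<le> B" "\<bar>h' s\<bar> \<le> B" for s
    unfolding h_def h'_def by (intro N.P.abs_expectation_le M.P.abs_expectation_le Suc.prems)+
  have inner: "\<bar>h' s - h s\<bar> \<le> B * (real k * e)" if "s \<in> space M" for s
    unfolding h_def h'_def
  proof (rule Suc.IH)
    have "s \<in> space Q" using that sets sets_eq_imp_space_eq by blast
    then show "(\<lambda>x. g (case_nat s x)) \<in> borel_measurable (\<Pi>\<^sub>M i\<in>UNIV. Q)" by measurable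
  next
    fix x y :: "nat \<Rightarrow> 'a" assume "\<And>i. i < k \<Longrightarrow> x i = y i"
    then show "g (case_nat s x) = g (case_nat s y)"
      by (intro Suc.prems(3)) (auto split: nat.split)
  qed (rule Suc.prems(2))
  have int: "integrable M h" "integrable M h'"
    using hB by (auto intro!: M.M.integrable_bounded)
  have "\<bar>(\<integral>s. h' s \<partial>M) - (\<integral>s. h s \<partial>M)\<bar> = \<bar>\<integral>s. h' s - h s \<partial>M\<bar>"
    using int by simp
  also have "\<dots> \<le> (\<integral>s. \<bar>h' s - h s\<bar> \<partial>M)" by (rule integral_abs_bound)
  also have "\<dots> \<le> B * (real k * e)"
    by (rule M.M.integral_le_const) (use int inner in auto)
  finally have 1: "\<bar>(\<integral>s. h' s \<partial>M) - (\<integral>s. h s \<partial>M)\<bar> \<le> B * (real k * e)" .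
  have 2: "\<bar>(\<integral>s. h s \<partial>M) - (\<integral>s. h s \<partial>N)\<bar> \<le> B * e"
    by (rule tv_boundD[OF tv h hB(1)])
  have "(\<integral>x. g x \<partial>M.S) = (\<integral>s. h' s \<partial>M)" "(\<integral>x. g x \<partial>N.S) = (\<integral>s. h s \<partial>N)"
    unfolding h_def h'_def
    by (rule M.integral_PiM_iter N.integral_PiM_iter, measurable, rule Suc.prems)+
  then show ?case using 1 2 by (simp add: algebra_simps)
qed

subsection \<open>Linear relaxation equations\<close>

text \<open>With the integrating factor the equation reads (exp(cs) u)' = c exp(cs) w, and the right
  side is at most c L d exp(c(L+1)s) in absolute value. An antiderivative of that bound has the
  coefficient L/(L+1) d.\<close>

lemma exp_comparison:
  fixes u w :: "real \<Rightarrow> real"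
  assumes "0 \<le> c" "0 \<le> L" "0 \<le> d" "0 \<le> t" "u 0 = 0"
    and u': "\<And>s. 0 \<le> s \<Longrightarrow> (u has_real_derivative c * (w s - u s)) (at s within {0..})"
    and w: "\<And>s. 0 \<le> s \<Longrightarrow> \<bar>w s\<bar> \<le> L * d * exp (c * L * s)"
  shows "\<bar>u t\<bar> \<le> L / (L + 1) * d * exp (c * L * t)"
proof -
  define q where "q = L / (L + 1)"
  have q: "q * (L + 1) = L" "0 \<le> q" using assms(2) by (auto simp: q_def)
  \<comment> \<open>Taking \<open>\<sigma>\<close> to be 1 and -1 gives the upper and the lower
    bound by one argument.\<close>
  have main: "\<sigma> * u t \<le> q * d * exp (c * L * t)" if \<sigma>: "\<bar>\<sigma>\<bar> = 1" for \<sigma> :: real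
  proof -
    \<comment> \<open>This is the gap between claimed bound and \<open>\<sigma> * u\<close>,
      multiplied by \<open>exp (c * s)\<close>. It starts at \<open>q * d\<close> because
      \<open>u 0 = 0\<close>, and \<open>q * (L + 1) = L\<close> makes its derivative
      nonnegative.\<close>
    define v where "v s = q * d * exp (c * (L + 1) * s) - \<sigma> * exp (c * s) * u s" for s
    define v' where "v' s = c * exp (c * s) * (L * d * exp (c * L * s) - \<sigma> * w s)" for s
    have "(v has_derivative (*) (v' s)) (at s within {0..t})" if "0 \<le> s" "s \<le> t" for s
    proof -
      have "(v has_real_derivative
          q * d * (c * (L + 1) * exp (c * (L + 1) * s))
            - (\<sigma> * (c * exp (c * s)) * u s + \<sigma> * exp (c * s) * (c * (w s - u s))))
          (at s within {0..t})"
        unfolding v_def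
        by (rule derivative_eq_intros DERIV_subset[OF u'] refl that | force simp: algebra_simps)+
      moreover have "q * d * (c * (L + 1) * exp (c * (L + 1) * s)) = c * exp (c * s) * (L * d * exp (c * L * s))"
        by (subst q(1)[symmetric]) (simp add: exp_add[symmetric] algebra_simps)
      ultimately show ?thesis
        by (simp add: has_field_derivative_def v'_def algebra_simps)
    qed
    from mvt_very_simple[OF assms(4) this] obtain s where s: "s \<in> {0..t}" "v t - v 0 = v' s * (t - 0)"
      by blast
    have "\<sigma> * w s \<le> \<bar>w s\<bar>" using \<sigma> by (metis abs_ge_self abs_mult mult_1)
    also have "\<dots> \<le> L * d * exp (c * L * s)" using w s(1) by simp
    finally have "0 \<le> v' s" using assms(1) by (simp add: v'_def)
    with s assms(4) have "v 0 \<le> v t" by (smt (verit) mult_nonneg_nonneg)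
    moreover have "0 \<le> v 0" using q assms by (simp add: v_def)
    ultimately have "exp (c * t) * (\<sigma> * u t) \<le> exp (c * t) * (q * d * exp (c * L * t))"
      by (simp add: v_def exp_add[symmetric] algebra_simps)
    then show ?thesis by simp
  qed
  show ?thesis using main[of 1] main[of "-1"] by (simp add: q_def abs_le_iff)
qed

text \<open>Adding \<open>B\<close> makes the integrand nonnegative, so the rule for nonnegative
  integrals over a bind applies; the shift cancels because all measures involved have mass
  1.\<close>

lemma integral_bind_bounded:
  fixes f :: "'b \<Rightarrow> real"
  assumes M: "prob_space M" and K: "K \<in> M \<rightarrow>\<^sub>M prob_algebra N"
    and f [measurable]: "f \<in> borel_measurable N" and B: "\<And>x. \<bar>f x\<bar> \<le> B"
  shows "(\<integral>y. f y \<partial>(M \<bind> K)) = (\<integral>x. (\<integral>y. f y \<partial>K x) \<partial>M)"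
proof -
  interpret M: prob_space M by fact
  note K' = measurable_prob_algebraD[OF K]
  have Kx: "prob_space (K x)" "sets (K x) = sets N" if "x \<in> space M" for x
    using prob_algebraD[OF measurable_space[OF K that]] by auto
  interpret MK: prob_space "M \<bind> K"
    by (rule M.prob_space_bind[OF _ K']) (use Kx in auto)
  have sets: "sets (M \<bind> K) = sets N"
    by (rule sets_bind) (use Kx M.not_empty in auto)
  have nonneg: "0 \<le> f x + B" for x using B[of x] by linarith
  have [measurable]: "(\<lambda>x. \<integral>y. f y \<partial>K x) \<in> borel_measurable M"
    using K' by measurable
  have [measurable]: "f \<in> borel_measurable (M \<bind> K)"
    using sets by (simp cong: measurable_cong_sets)
  have bd: "\<bar>\<integral>y. f y \<partial>K x\<bar> \<le> B" if "x \<in> space M" for x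
    using Kx[OF that] B by (intro prob_space.abs_expectation_le)
  have inner: "(\<integral>\<^sup>+y. ennreal (f y + B) \<partial>K x) = ennreal ((\<integral>y. f y \<partial>K x) + B)" if "x \<in> space M" for x
  proof -
    interpret Kx: prob_space "K x" by (rule Kx[OF that])
    have [measurable]: "f \<in> borel_measurable (K x)"
      using Kx(2)[OF that] by (simp cong: measurable_cong_sets)
    have int: "integrable (K x) f" by (rule Kx.integrable_bounded[OF _ B]) simp
    then have "(\<integral>\<^sup>+y. ennreal (f y + B) \<partial>K x) = ennreal (\<integral>y. f y + B \<partial>K x)"
      by (intro nn_integral_eq_integral) (auto simp: nonneg)
    with int show ?thesis by (simp add: Kx.prob_space)
  qed
  have intM: "integrable M (\<lambda>x. \<integral>y. f y \<partial>K x)"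
    by (rule M.integrable_const_bound[where B = B]) (use bd in auto)
  have intMK: "integrable (M \<bind> K) f" by (rule MK.integrable_bounded[OF _ B]) measurable
  have "ennreal ((\<integral>y. f y \<partial>(M \<bind> K)) + B) = ennreal (\<integral>y. f y + B \<partial>(M \<bind> K))"
    using intMK by (simp add: MK.prob_space)
  also have "\<dots> = (\<integral>\<^sup>+y. ennreal (f y + B) \<partial>(M \<bind> K))"
    using intMK by (intro nn_integral_eq_integral[symmetric]) (auto simp: nonneg)
  also have "\<dots> = (\<integral>\<^sup>+x. (\<integral>\<^sup>+y. ennreal (f y + B) \<partial>K x) \<partial>M)"
    by (rule nn_integral_bind[OF _ K']) measurable
  also have "\<dots> = (\<integral>\<^sup>+x. ennreal ((\<integral>y. f y \<partial>K x) + B) \<partial>M)"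
    by (intro nn_integral_cong inner)
  also have "\<dots> = ennreal (\<integral>x. (\<integral>y. f y \<partial>K x) + B \<partial>M)"
  proof (intro nn_integral_eq_integral AE_I2)
    show "0 \<le> (\<integral>y. f y \<partial>K x) + B" if "x \<in> space M" for x using bd[OF that] by linarith
  qed (use intM in simp)
  also have "\<dots> = ennreal ((\<integral>x. (\<integral>y. f y \<partial>K x) \<partial>M) + B)"
    using intM by (simp add: M.prob_space)
  finally show ?thesis
  proof (subst (asm) ennreal_inj)
    show "0 \<le> (\<integral>y. f y \<partial>(M \<bind> K)) + B" using MK.abs_expectation_le[of f, OF B] by (simp add: abs_le_iff)
    have "- B \<le> (\<integral>x. (\<integral>y. f y \<partial>K x) \<partial>M)"
      by (rule M.integral_ge_const) (use intM bd in \<open>auto simp: abs_le_iff minus_le_iff\<close>)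
    then show "0 \<le> (\<integral>x. (\<integral>y. f y \<partial>K x) \<partial>M) + B" by simp
  qed simp
qed

text \<open>The event \<open>\<tau> > t\<close> has probability exp(-ct) and contributes
  \<open>a\<close>; on its complement the substitution s = t - \<tau> splits the density c
  exp(-c\<tau>) into exp(-ct) and c exp(cs). The result is the variation of constants formula for m'
  = c (F - m) with m(0) = a.\<close>

lemma expectation_exponential_shift:
  fixes F :: "real \<Rightarrow> real"
  assumes c: "0 < c" and t: "0 \<le> t" and F: "continuous_on {0..} F"
  shows "(\<integral>\<tau>. (if \<tau> \<le> t then F (t - \<tau>) else a) \<partial>density lborel (exponential_density c)) =
    exp (- c * t) * (a + integral {0..t} (\<lambda>s. c * exp (c * s) * F s))"
proof -
  let ?E = "density lborel (exponential_density c)"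
  let ?H = "\<lambda>\<tau>. if \<tau> \<le> t then F (t - \<tau>) else a"
  interpret E: prob_space ?E by (rule prob_space_exponential_density) fact
  \<comment> \<open>\<open>F\<close> is continuous on the half-line only; clamping the argument at 0
    gives a function continuous everywhere that agrees where \<open>\<tau> \<le> t\<close>.\<close>
  have "continuous_on UNIV (\<lambda>\<tau>. F (max 0 (t - \<tau>)))"
    by (rule continuous_on_compose2[OF F]) (auto intro!: continuous_intros)
  then have "(\<lambda>\<tau>. F (max 0 (t - \<tau>))) \<in> borel_measurable borel"
    by (rule borel_measurable_continuous_onI)
  then have "(\<lambda>\<tau>. if \<tau> \<le> t then F (max 0 (t - \<tau>)) else a) \<in> borel_measurable borel"
    by measurable
  also have "(\<lambda>\<tau>. if \<tau> \<le> t then F (max 0 (t - \<tau>)) else a) = ?H"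
    by auto
  finally have H [measurable]: "?H \<in> borel_measurable borel" .
  define g where "g \<tau> = indicator {0..t} \<tau> *\<^sub>R (c * exp (- c * \<tau>) * F (t - \<tau>))" for \<tau>
  define h where "h s = indicator {0..t} s *\<^sub>R (c * exp (c * s) * F s)" for s
  have "integrable lborel g" unfolding g_def
    by (intro borel_integrable_compact continuous_intros continuous_on_compose2[OF F]) auto
  have tail: "(\<integral>\<tau>. indicator {t<..} \<tau> * exponential_density c \<tau> \<partial>lborel) = exp (- c * t)"
    "integrable lborel (\<lambda>\<tau>. indicator {t<..} \<tau> * exponential_density c \<tau>)"
  proof -
    have "emeasure ?E {..t} = ennreal (1 - exp (- c * t))"
      using emeasure_erlang_density[OF c, of 0 t] t by (simp add: erlang_CDF_def)
    then have "measure ?E {..t} = 1 - exp (- c * t)"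
      using c t by (simp add: measure_def)
    moreover have "{t<..} = space ?E - {..t}" by auto
    ultimately have "measure ?E {t<..} = exp (- c * t)"
      using E.prob_compl[of "{..t}"] by simp
    then have *: "(\<integral>\<tau>. indicator {t<..} \<tau> \<partial>?E) = exp (- c * t)" by simp
    have "integrable ?E (indicat_real {t<..})" by (intro E.integrable_bounded[where B = 1]) (auto simp: indicator_def)
    then show "integrable lborel (\<lambda>\<tau>. indicator {t<..} \<tau> * exponential_density c \<tau>)"
      using c by (subst (asm) integrable_real_density) (auto simp: mult.commute)
    show "(\<integral>\<tau>. indicator {t<..} \<tau> * exponential_density c \<tau> \<partial>lborel) = exp (- c * t)"
      using * c by (subst (asm) integral_real_density) (auto simp: mult.commute)
  qed
  have "(\<integral>\<tau>. ?H \<tau> \<partial>?E) = (\<integral>\<tau>. exponential_density c \<tau> * ?H \<tau> \<partial>lborel)"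
    by (rule integral_real_density) (use c in auto)
  also have "\<dots> = (\<integral>\<tau>. g \<tau> + a * (indicator {t<..} \<tau> * exponential_density c \<tau>) \<partial>lborel)"
    using t by (intro Bochner_Integration.integral_cong)
      (auto simp: g_def exponential_density_def indicator_def)
  also have "\<dots> = (\<integral>\<tau>. g \<tau> \<partial>lborel) + a * exp (- c * t)"
    using \<open>integrable lborel g\<close> tail by simp
  also have "(\<integral>\<tau>. g \<tau> \<partial>lborel) = (\<integral>s. g (t + (- 1) * s) \<partial>lborel)"
    by (subst lborel_integral_real_affine[where c = "- 1" and t = t]) auto
  also have "\<dots> = (\<integral>s. exp (- c * t) * h s \<partial>lborel)"
    by (intro Bochner_Integration.integral_cong)
      (auto simp: g_def h_def indicator_def exp_add[symmetric] algebra_simps)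
  also have "\<dots> = exp (- c * t) * (\<integral>s. h s \<partial>lborel)" by simp
  also have "(\<integral>s. h s \<partial>lborel) = integral {0..t} (\<lambda>s. c * exp (c * s) * F s)"
  proof -
    have "set_integrable lborel {0..t} (\<lambda>s. c * exp (c * s) * F s)"
      by (intro borel_integrable_atLeastAtMost' continuous_intros continuous_on_subset[OF F]) auto
    from set_borel_integral_eq_integral(2)[OF this] show ?thesis
      by (simp add: h_def set_lebesgue_integral_def)
  qed
  finally show ?thesis by (simp add: algebra_simps)
qed

text \<open>Defining the solution as a mixture makes it a probability measure by construction, with
  no integration of measure-valued curves. A test function then sees only the scalar variation of
  constants formula, which is differentiated. The hypothesis \<open>cont\<close> serves twice: for
  measurability of the mixing kernel and for the fundamental theorem of calculus.\<close>

lemma relaxation_exists: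
  fixes K :: "real \<Rightarrow> 's measure"
  assumes c: "0 < c" and M0: "M0 \<in> space (prob_algebra Q)"
    and K: "\<And>s. 0 \<le> s \<Longrightarrow> K s \<in> space (prob_algebra Q)"
    and cont: "\<And>(f :: 's \<Rightarrow> real) B. f \<in> borel_measurable Q \<Longrightarrow> (\<And>x. \<bar>f x\<bar> \<le> B) \<Longrightarrow>
      continuous_on {0..} (\<lambda>s. \<integral>x. f x \<partial>K s)"
  shows "\<exists>M. (\<forall>t\<ge>0. M t \<in> space (prob_algebra Q)) \<and> M 0 = M0 \<and>
    (\<forall>(f :: 's \<Rightarrow> real) B t. f \<in> borel_measurable Q \<longrightarrow> (\<forall>x. \<bar>f x\<bar> \<le> B) \<longrightarrow> 0 \<le> t \<longrightarrow>
      ((\<lambda>s. \<integral>x. f x \<partial>M s) has_real_derivative c * ((\<integral>x. f x \<partial>K t) - (\<integral>x. f x \<partial>M t)))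
        (at t within {0..}))"
proof -
  let ?E = "density lborel (exponential_density c)"
  interpret E: prob_space ?E by (rule prob_space_exponential_density) fact
  define K' where "K' t \<tau> = (if \<tau> \<le> t then K (t - \<tau>) else M0)" for t \<tau> :: real
  define M where "M t = (?E \<bind> K' t)" for t
  have K'_space: "K' t \<tau> \<in> space (prob_algebra Q)" for t \<tau>
    using K M0 by (simp add: K'_def)
  have K'_int: "(\<integral>x. f x \<partial>K' t \<tau>) = (if \<tau> \<le> t then (\<integral>x. f x \<partial>K (t - \<tau>)) else (\<integral>x. f x \<partial>M0))"
    for f :: "'s \<Rightarrow> real" and t \<tau>
    by (simp add: K'_def)
  have K'_meas: "K' t \<in> ?E \<rightarrow>\<^sub>M prob_algebra Q" if "0 \<le> t" for t
  proof (intro measurable_prob_algebraI measurable_subprob_algebra)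
    \<comment> \<open>The kernel is tested on one set at a time, through the expectation of its
      indicator, to which \<open>cont\<close> applies.\<close>
    fix A assume A: "A \<in> sets Q"
    have "continuous_on {0..} (\<lambda>s. \<integral>x. indicat_real A x \<partial>K s)"
      using A by (intro cont[where B = 1]) (auto simp: indicator_def)
    then have "continuous_on UNIV (\<lambda>\<tau>. \<integral>x. indicat_real A x \<partial>K (max 0 (t - \<tau>)))"
      by (rule continuous_on_compose2) (auto intro!: continuous_intros)
    then have "(\<lambda>\<tau>. \<integral>x. indicat_real A x \<partial>K (max 0 (t - \<tau>))) \<in> borel_measurable borel"
      by (rule borel_measurable_continuous_onI)
    then have "(\<lambda>\<tau>. if \<tau> \<le> t then (\<integral>x. indicat_real A x \<partial>K (max 0 (t - \<tau>))) else (\<integral>x. indicat_real A x \<partial>M0))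
        \<in> borel_measurable borel" by measurable
    then have "(\<lambda>\<tau>. ennreal (if \<tau> \<le> t then (\<integral>x. indicat_real A x \<partial>K (max 0 (t - \<tau>))) else (\<integral>x. indicat_real A x \<partial>M0)))
        \<in> borel_measurable borel" by measurable
    also have "(\<lambda>\<tau>. ennreal (if \<tau> \<le> t then (\<integral>x. indicat_real A x \<partial>K (max 0 (t - \<tau>))) else (\<integral>x. indicat_real A x \<partial>M0)))
        = (\<lambda>\<tau>. emeasure (K' t \<tau>) A)"
    proof
      fix \<tau>
      interpret K': prob_space "K' t \<tau>" using prob_algebraD[OF K'_space] by blast
      have "A \<in> sets (K' t \<tau>)" using A prob_algebraD[OF K'_space] by blast
      then have "emeasure (K' t \<tau>) A = ennreal (\<integral>x. indicat_real A x \<partial>K' t \<tau>)"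
        by (simp add: K'.emeasure_eq_measure)
      then show "ennreal (if \<tau> \<le> t then (\<integral>x. indicat_real A x \<partial>K (max 0 (t - \<tau>))) else (\<integral>x. indicat_real A x \<partial>M0))
          = emeasure (K' t \<tau>) A"
        unfolding K'_int by simp
    qed
    finally show "(\<lambda>\<tau>. emeasure (K' t \<tau>) A) \<in> borel_measurable ?E"
      by simp
  qed (use prob_algebraD[OF K'_space] prob_space_imp_subprob_space in blast)+
  have M_space: "M t \<in> space (prob_algebra Q)" if "0 \<le> t" for t
  proof -
    have "prob_space (M t)" unfolding M_def
      by (rule E.prob_space_bind[OF _ measurable_prob_algebraD[OF K'_meas[OF that]]])
         (use prob_algebraD[OF K'_space] in blast)
    moreover have "sets (M t) = sets Q" unfolding M_def
      by (rule sets_bind) (use prob_algebraD[OF K'_space] in auto)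
    ultimately show ?thesis by (simp add: space_prob_algebra)
  qed
  have M_int: "(\<integral>x. f x \<partial>M t) = exp (- c * t) *
      ((\<integral>x. f x \<partial>M0) + integral {0..t} (\<lambda>s. c * exp (c * s) * (\<integral>x. f x \<partial>K s)))"
    if "f \<in> borel_measurable Q" "\<And>x. \<bar>f x\<bar> \<le> B" "0 \<le> t" for f :: "'s \<Rightarrow> real" and B t
    unfolding M_def integral_bind_bounded[OF E.prob_space_axioms K'_meas[OF that(3)] that(1,2)] K'_int
    by (rule expectation_exponential_shift[OF c that(3) cont[OF that(1,2)]])
  \<comment> \<open>At time 0 the event \<open>\<tau> \<le> 0\<close> has no mass; in
    \<open>M_int\<close> this is the vanishing integral over \<open>{0..0}\<close>.\<close>
  have "M 0 = M0"
  proof (rule tv_bound_0_eq)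
    show "tv_bound 0 (M 0) M0"
      unfolding tv_bound_def
    proof (intro allI impI)
      fix f :: "'s \<Rightarrow> real" and B assume f: "f \<in> borel_measurable (M 0)" "\<forall>x. \<bar>f x\<bar> \<le> B"
      have "f \<in> borel_measurable Q"
        using f(1) prob_algebraD[OF M_space] by (simp cong: measurable_cong_sets)
      from M_int[OF this, of B 0] f(2) show "\<bar>(\<integral>x. f x \<partial>M 0) - (\<integral>x. f x \<partial>M0)\<bar> \<le> B * 0"
        by simp
    qed
  qed (use prob_algebraD[OF M_space] prob_algebraD[OF M0] in auto)
  moreover have "((\<lambda>s. \<integral>x. f x \<partial>M s) has_real_derivative c * ((\<integral>x. f x \<partial>K t) - (\<integral>x. f x \<partial>M t)))
        (at t within {0..})"
    if f: "f \<in> borel_measurable Q" "\<And>x. \<bar>f x\<bar> \<le> B" and t: "0 \<le> t" for f :: "'s \<Rightarrow> real" and B t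
  proof -
    define G where "G s = c * exp (c * s) * (\<integral>x. f x \<partial>K s)" for s
    define m where "m s = exp (- c * s) * ((\<integral>x. f x \<partial>M0) + integral {0..s} G)" for s
    have G: "continuous_on {0..} G"
      unfolding G_def by (intro continuous_intros cont[OF f])
    \<comment> \<open>The fundamental theorem is used on a compact interval. Ending it at
      \<open>t + 1\<close> and not at \<open>t\<close> makes it agree with \<open>{0..}\<close> near
      \<open>t\<close>, so the derivative is two-sided for positive \<open>t\<close>.\<close>
    have "((\<lambda>s. integral {0..s} G) has_real_derivative G t) (at t within {0..t + 1})"
      using t by (intro integral_has_real_derivative continuous_on_subset[OF G]) auto
    also have "at t within {0..t + 1} = at t within {0..}"
      using t by (intro at_within_nhd[of t "{..<t + 1}"]) auto
    finally have "(m has_real_derivative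
        - c * exp (- c * t) * ((\<integral>x. f x \<partial>M0) + integral {0..t} G) + exp (- c * t) * G t) (at t within {0..})"
      unfolding m_def by (auto intro!: derivative_eq_intros)
    also have "- c * exp (- c * t) * ((\<integral>x. f x \<partial>M0) + integral {0..t} G) + exp (- c * t) * G t
        = c * ((\<integral>x. f x \<partial>K t) - m t)"
      by (simp add: m_def G_def algebra_simps exp_minus)
    also have "m t = (\<integral>x. f x \<partial>M t)"
      unfolding m_def G_def by (rule M_int[OF f t, symmetric])
    finally have m': "(m has_real_derivative c * ((\<integral>x. f x \<partial>K t) - (\<integral>x. f x \<partial>M t))) (at t within {0..})" .
    show ?thesis
    proof (rule has_field_derivative_transform_within[OF m' zero_less_one])
      show "m s = (\<integral>x. f x \<partial>M s)" if "s \<in> {0..}" for s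
        unfolding m_def G_def using that by (intro M_int[OF f, symmetric]) auto
    qed (use t in auto)
  qed
  ultimately show ?thesis using M_space by (intro exI[of _ M]) blast
qed

subsection \<open>The mean-field equation\<close>

lemma continuous_on_expectation:
  fixes f :: "'a \<Rightarrow> real"
  assumes lip: "\<And>s t. 0 \<le> s \<Longrightarrow> 0 \<le> t \<Longrightarrow> tv_bound (C * \<bar>t - s\<bar>) (M s) (M t)" and "0 \<le> C"
    and sets: "\<And>t. 0 \<le> t \<Longrightarrow> sets (M t) = sets Q"
    and f: "f \<in> borel_measurable Q" "\<And>x. \<bar>f x\<bar> \<le> B"
  shows "continuous_on {0..} (\<lambda>t. \<integral>x. f x \<partial>M t)"
proof (rule lipschitz_on_continuous_on[of "B * C"], rule lipschitz_onI)
  show "0 \<le> B * C" using f(2)[of undefined] \<open>0 \<le> C\<close> by simp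
  fix s t :: real assume st: "s \<in> {0..}" "t \<in> {0..}"
  then have "f \<in> borel_measurable (M t)" using f(1) sets by (simp cong: measurable_cong_sets)
  with st tv_boundD[OF lip this f(2), of s] show
    "dist (\<integral>x. f x \<partial>M s) (\<integral>x. f x \<partial>M t) \<le> B * C * dist s t"
    by (simp add: dist_real_def abs_minus_commute mult.assoc)
qed

section \<open>The map T and its Lipschitz constant\<close>

locale mean_field =
  fixes r :: "'w::topological_space measure"
    and \<gamma> :: "'w \<Rightarrow> (nat \<Rightarrow> 's) \<Rightarrow> 's::topological_space"
    and \<kappa> :: "'w \<Rightarrow> nat"
  assumes sets_r: "sets r = sets borel" and fin_r: "finite_measure r"
    and r_nz: "emeasure r (space r) \<noteq> 0"
    and \<gamma>_meas: "(\<lambda>(\<omega>, x). \<gamma> \<omega> x) \<in> borel \<Otimes>\<^sub>M (\<Pi>\<^sub>M i\<in>UNIV. borel) \<rightarrow>\<^sub>M borel"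
    and \<kappa>_meas: "\<kappa> \<in> borel \<rightarrow>\<^sub>M count_space UNIV"
    and \<gamma>_local: "\<And>\<omega> x y. (\<And>i. i < \<kappa> \<omega> \<Longrightarrow> x i = y i) \<Longrightarrow> \<gamma> \<omega> x = \<gamma> \<omega> y"
    and \<kappa>_fin: "(\<integral>\<^sup>+\<omega>. of_nat (\<kappa> \<omega>) \<partial>r) < \<infinity>"
begin

abbreviation "R \<equiv> normalize_measure r"
abbreviation "T \<equiv> mf_map r \<gamma>"
abbreviation "\<P> \<equiv> space (prob_algebra (borel :: 's measure))"

definition c where "c = total_mass r"
definition L where "L = (\<integral>\<omega>. real (\<kappa> \<omega>) \<partial>R)"
definition q where "q = L / (L + 1)"

lemma sets_R [simp, measurable_cong]: "sets R = sets borel"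
  by (simp add: normalize_measure_def sets_r)

lemma r_fin: "emeasure r (space r) \<noteq> \<infinity>"
  using finite_measure.emeasure_finite[OF fin_r] by simp

lemma prob_R: "prob_space R"
proof (rule prob_spaceI)
  show "emeasure R (space R) = 1"
    using r_nz r_fin ennreal_divide_self[of "emeasure r (space r)"]
    by (simp add: normalize_measure_def space_scale_measure divide_ennreal_def mult.commute less_top)
qed

sublocale R: prob_space R by (rule prob_R)

lemma c_pos: "0 < c"
  using r_nz r_fin fin_r by (simp add: c_def total_mass_def finite_measure.emeasure_eq_measure
      zero_less_measure_iff)

lemma integrable_\<kappa>: "integrable R (\<lambda>\<omega>. real (\<kappa> \<omega>))"
proof (rule integrableI_nonneg)
  have [measurable]: "\<kappa> \<in> r \<rightarrow>\<^sub>M count_space UNIV"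
    using \<kappa>_meas sets_r by (simp cong: measurable_cong_sets)
  have "(\<integral>\<^sup>+\<omega>. ennreal (real (\<kappa> \<omega>)) \<partial>R) =
      inverse (emeasure r (space r)) * (\<integral>\<^sup>+\<omega>. of_nat (\<kappa> \<omega>) \<partial>r)"
    unfolding normalize_measure_def by (simp add: nn_integral_scale_measure ennreal_of_nat_eq_real_of_nat)
  also have "\<dots> < \<infinity>"
    using \<kappa>_fin r_nz by (auto simp: less_top[symmetric] ennreal_mult_eq_top_iff)
  finally show "(\<integral>\<^sup>+\<omega>. ennreal (real (\<kappa> \<omega>)) \<partial>R) < \<infinity>" .
qed (use \<kappa>_meas in measurable)

lemma L_nonneg: "0 \<le> L"
  by (simp add: L_def)

lemma q: "0 \<le> q" "q < 1" "(L + 1) * q = L"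
  using L_nonneg by (auto simp: q_def)

lemma sets_PiM_borel:
  assumes "M \<in> \<P>"
  shows "sets (\<Pi>\<^sub>M i\<in>(UNIV :: nat set). M) = sets (\<Pi>\<^sub>M i\<in>UNIV. borel)"
  using prob_algebraD[OF assms] by (intro sets_PiM_cong) auto

lemma prob_PiM: "M \<in> \<P> \<Longrightarrow> prob_space (\<Pi>\<^sub>M i\<in>(UNIV :: nat set). M)"
  by (intro prob_space_PiM prob_algebraD)

lemma \<gamma>_meas':
  assumes "M \<in> \<P>"
  shows "(\<lambda>(\<omega>, x). \<gamma> \<omega> x) \<in> R \<Otimes>\<^sub>M (\<Pi>\<^sub>M i\<in>UNIV. M) \<rightarrow>\<^sub>M borel"
  using \<gamma>_meas sets_pair_measure_cong[OF sets_R sets_PiM_borel[OF assms]]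
  by (simp cong: measurable_cong_sets)

lemma T_space: "M \<in> \<P> \<Longrightarrow> T M \<in> \<P>"
  unfolding mf_map_def
  by (auto simp: space_prob_algebra[of borel] intro!: prob_space.prob_space_distr \<gamma>_meas'
      prob_space_pair prob_R prob_PiM)

lemma T_integral:
  assumes M: "M \<in> \<P>" and f [measurable]: "f \<in> borel_measurable borel" and B: "\<And>x. \<bar>f x\<bar> \<le> (B :: real)"
  shows "(\<integral>x. f x \<partial>T M) = (\<integral>\<omega>. (\<integral>x. f (\<gamma> \<omega> x) \<partial>(\<Pi>\<^sub>M i\<in>UNIV. M)) \<partial>R)"
proof -
  note [measurable] = \<gamma>_meas'[OF M]
  interpret S: prob_space "\<Pi>\<^sub>M i\<in>(UNIV :: nat set). M" by (rule prob_PiM[OF M])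
  interpret RS: pair_prob_space R "\<Pi>\<^sub>M i\<in>(UNIV :: nat set). M" ..
  have "(\<integral>x. f x \<partial>T M) = (\<integral>p. f ((\<lambda>(\<omega>, x). \<gamma> \<omega> x) p) \<partial>(R \<Otimes>\<^sub>M (\<Pi>\<^sub>M i\<in>UNIV. M)))"
    unfolding mf_map_def by (rule integral_distr) measurable
  also have "\<dots> = (\<integral>\<omega>. (\<integral>x. f (\<gamma> \<omega> x) \<partial>(\<Pi>\<^sub>M i\<in>UNIV. M)) \<partial>R)"
    by (subst RS.integral_fst'[symmetric]) (auto intro!: RS.integrable_bounded[where B = B] B)
  finally show ?thesis .
qed

text \<open>For fixed \<open>\<omega>\<close> the map reads \<open>\<kappa> \<omega>\<close> inputs,
  so the two inner expectations differ by at most \<open>B * (real (\<kappa> \<omega>) * e)\<close>.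
  Averaging over \<open>\<omega>\<close> replaces \<open>\<kappa> \<omega>\<close> by its mean,
  which is finite by \<open>integrable_\<kappa>\<close>.\<close>

lemma T_lipschitz:
  assumes M: "M \<in> \<P>" and N: "N \<in> \<P>" and tv: "tv_bound e M N"
  shows "tv_bound (L * e) (T M) (T N)"
  unfolding tv_bound_def
proof (intro allI impI)
  fix f :: "'s \<Rightarrow> real" and B assume f': "f \<in> borel_measurable (T M)" and B': "\<forall>x. \<bar>f x\<bar> \<le> B"
  then have B: "\<bar>f x\<bar> \<le> B" for x by blast
  have f [measurable]: "f \<in> borel_measurable borel"
    using f' prob_algebraD[OF T_space[OF M]] by (simp cong: measurable_cong_sets)
  define h where "h P \<omega> = (\<integral>x. f (\<gamma> \<omega> x) \<partial>(\<Pi>\<^sub>M i\<in>UNIV. P))" for P \<omega>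
  have int: "integrable R (h P)" if P: "P \<in> \<P>" for P
  proof -
    interpret S: prob_space "\<Pi>\<^sub>M i\<in>(UNIV :: nat set). P" by (rule prob_PiM[OF P])
    note [measurable] = \<gamma>_meas'[OF P]
    have "(\<lambda>(\<omega>, x). f (\<gamma> \<omega> x)) = (\<lambda>p. f ((\<lambda>(\<omega>, x). \<gamma> \<omega> x) p))" by auto
    then have "(\<lambda>(\<omega>, x). f (\<gamma> \<omega> x)) \<in> borel_measurable (R \<Otimes>\<^sub>M (\<Pi>\<^sub>M i\<in>UNIV. P))" by simp
    then have "h P \<in> borel_measurable R"
      unfolding h_def by (rule S.borel_measurable_lebesgue_integral)
    then show ?thesis
      by (rule R.integrable_bounded[where B = B]) (unfold h_def, intro S.abs_expectation_le B)
  qed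
  have "\<bar>h M \<omega> - h N \<omega>\<bar> \<le> B * (real (\<kappa> \<omega>) * e)" for \<omega>
    unfolding h_def
  proof (rule tv_bound_PiM_prefix[OF tv])
    have "(\<lambda>x. (\<lambda>(\<omega>, x). \<gamma> \<omega> x) (\<omega>, x)) \<in> (\<Pi>\<^sub>M i\<in>UNIV. borel) \<rightarrow>\<^sub>M borel"
      using \<gamma>_meas by measurable
    then show "(\<lambda>x. f (\<gamma> \<omega> x)) \<in> borel_measurable (\<Pi>\<^sub>M i\<in>UNIV. borel)" by simp
    show "f (\<gamma> \<omega> x) = f (\<gamma> \<omega> y)" if "\<And>i. i < \<kappa> \<omega> \<Longrightarrow> x i = y i" for x y
      using \<gamma>_local[OF that] by simp
  qed (use B prob_algebraD[OF M] prob_algebraD[OF N] in auto)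
  then have "(\<integral>\<omega>. \<bar>h M \<omega> - h N \<omega>\<bar> \<partial>R) \<le> (\<integral>\<omega>. B * (real (\<kappa> \<omega>) * e) \<partial>R)"
    by (intro integral_mono) (use int M N integrable_\<kappa> in auto)
  also have "\<dots> = B * (L * e)" by (simp add: L_def)
  finally have "(\<integral>\<omega>. \<bar>h M \<omega> - h N \<omega>\<bar> \<partial>R) \<le> B * (L * e)" .
  moreover have "\<bar>(\<integral>\<omega>. h M \<omega> \<partial>R) - (\<integral>\<omega>. h N \<omega> \<partial>R)\<bar> \<le> (\<integral>\<omega>. \<bar>h M \<omega> - h N \<omega>\<bar> \<partial>R)"
    using int M N integral_abs_bound[of R "\<lambda>\<omega>. h M \<omega> - h N \<omega>"] by simp
  ultimately show "\<bar>(\<integral>x. f x \<partial>T M) - (\<integral>x. f x \<partial>T N)\<bar> \<le> B * (L * e)"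
    unfolding T_integral[OF M f B] T_integral[OF N f B] h_def by linarith
qed

section \<open>Curves driven by other curves\<close>

text \<open>One Picard step from \<open>N\<close> to \<open>M\<close>, tested against bounded
  measurable functions; \<open>driven M M\<close> is the mean-field equation. It is a relation
  because \<open>M\<close> is left open at negative times.\<close>

definition driven :: "(real \<Rightarrow> 's measure) \<Rightarrow> (real \<Rightarrow> 's measure) \<Rightarrow> bool" where
  "driven M N \<longleftrightarrow> (\<forall>f B t. f \<in> borel_measurable borel \<longrightarrow> (\<forall>x. \<bar>f x\<bar> \<le> B) \<longrightarrow> 0 \<le> t \<longrightarrow>
     ((\<lambda>s. \<integral>x. f x \<partial>M s) has_real_derivative c * ((\<integral>x. f x \<partial>T (N t)) - (\<integral>x. f x \<partial>M t)))
       (at t within {0..}))"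

lemma drivenD:
  fixes f :: "'s \<Rightarrow> real"
  assumes "driven M N" "f \<in> borel_measurable borel" "\<And>x. \<bar>f x\<bar> \<le> B" "0 \<le> t"
  shows "((\<lambda>s. \<integral>x. f x \<partial>M s) has_real_derivative c * ((\<integral>x. f x \<partial>T (N t)) - (\<integral>x. f x \<partial>M t)))
       (at t within {0..})"
  using assms unfolding driven_def by blast

text \<open>The domain of the Picard step. The right side of a driven equation is c times a
  difference of two probability measures, hence the constant \<open>2 * c\<close>. Since T is
  Lipschitz, these curves stay continuous after T, as the linear equation requires, and the bound
  survives limits.\<close>

definition curves :: "(real \<Rightarrow> 's measure) set" where
  "curves = {M. (\<forall>t\<ge>0. M t \<in> \<P>) \<and>
     (\<forall>s\<ge>0. \<forall>t\<ge>0. tv_bound (2 * c * \<bar>t - s\<bar>) (M s) (M t))}"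

lemma curvesD:
  assumes "M \<in> curves" "0 \<le> t"
  shows "M t \<in> \<P>" "0 \<le> s \<Longrightarrow> tv_bound (2 * c * \<bar>t - s\<bar>) (M s) (M t)"
  using assms by (auto simp: curves_def)

text \<open>By the mean value theorem an increment over [s, t] is c (t - s) times a difference of
  two expectations, each at most \<open>B\<close>. This keeps the Picard step inside
  \<open>curves\<close> and also places every mean-field solution there, so that uniqueness covers
  all solutions.\<close>

lemma driven_curves:
  assumes M: "\<And>t. 0 \<le> t \<Longrightarrow> M t \<in> \<P>" and N: "\<And>t. 0 \<le> t \<Longrightarrow> N t \<in> \<P>" and "driven M N"
  shows "M \<in> curves"
proof -
  have le: "tv_bound (2 * c * (t - s)) (M s) (M t)" if st: "0 \<le> s" "s \<le> t" for s t
    unfolding tv_bound_def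
  proof (intro allI impI)
    fix f :: "'s \<Rightarrow> real" and B assume f': "f \<in> borel_measurable (M s)" and B': "\<forall>x. \<bar>f x\<bar> \<le> B"
    then have B: "\<bar>f x\<bar> \<le> B" for x by blast
    have f: "f \<in> borel_measurable borel"
      using f' prob_algebraD[OF M[OF st(1)]] by (simp cong: measurable_cong_sets)
    have "((\<lambda>s. \<integral>x. f x \<partial>M s) has_derivative (*) (c * ((\<integral>x. f x \<partial>T (N u)) - (\<integral>x. f x \<partial>M u))))
        (at u within {s..t})" if "s \<le> u" "u \<le> t" for u
      using drivenD[OF assms(3) f B, of u] that st
      by (auto simp: has_field_derivative_def intro: has_derivative_subset)
    from mvt_very_simple[OF st(2) this] obtain u where u: "u \<in> {s..t}"
      "(\<integral>x. f x \<partial>M t) - (\<integral>x. f x \<partial>M s) = c * ((\<integral>x. f x \<partial>T (N u)) - (\<integral>x. f x \<partial>M u)) * (t - s)"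
      by blast
    have "0 \<le> u" using u st by simp
    then have "\<bar>\<integral>x. f x \<partial>T (N u)\<bar> \<le> B" "\<bar>\<integral>x. f x \<partial>M u\<bar> \<le> B"
      by (auto intro!: prob_space.abs_expectation_le B prob_algebraD T_space N M)
    then have "\<bar>(\<integral>x. f x \<partial>T (N u)) - (\<integral>x. f x \<partial>M u)\<bar> \<le> 2 * B" by linarith
    then have "c * \<bar>(\<integral>x. f x \<partial>T (N u)) - (\<integral>x. f x \<partial>M u)\<bar> * (t - s) \<le> c * (2 * B) * (t - s)"
      using c_pos st by (intro mult_right_mono mult_left_mono) auto
    moreover have "\<bar>(\<integral>x. f x \<partial>M s) - (\<integral>x. f x \<partial>M t)\<bar> = c * \<bar>(\<integral>x. f x \<partial>T (N u)) - (\<integral>x. f x \<partial>M u)\<bar> * (t - s)"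
      unfolding abs_minus_commute[of "\<integral>x. f x \<partial>M s"] u(2) using c_pos st by (simp add: abs_mult)
    ultimately show "\<bar>(\<integral>x. f x \<partial>M s) - (\<integral>x. f x \<partial>M t)\<bar> \<le> B * (2 * c * (t - s))"
      by (simp add: mult_ac)
  qed
  have "tv_bound (2 * c * \<bar>t - s\<bar>) (M s) (M t)" if st: "0 \<le> s" "0 \<le> t" for s t
  proof (cases "s \<le> t")
    case True
    with le[of s t] st show ?thesis by simp
  next
    case False
    then have "tv_bound (2 * c * (s - t)) (M s) (M t)"
      using st prob_algebraD(2)[OF M] by (intro tv_bound_sym[OF le]) auto
    with False show ?thesis by simp
  qed
  with M show ?thesis by (simp add: curves_def)
qed

lemma curves_continuous:
  fixes f :: "'s \<Rightarrow> real"
  assumes M: "M \<in> curves" and f: "f \<in> borel_measurable borel" "\<And>x. \<bar>f x\<bar> \<le> B"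
  shows "continuous_on {0..} (\<lambda>t. \<integral>x. f x \<partial>M t)" "continuous_on {0..} (\<lambda>t. \<integral>x. f x \<partial>T (M t))"
proof -
  note P = curvesD(1)[OF M]
  show "continuous_on {0..} (\<lambda>t. \<integral>x. f x \<partial>M t)"
    by (rule continuous_on_expectation[OF curvesD(2)[OF M] _ _ f])
       (use c_pos prob_algebraD(2)[OF P] in auto)
  have "tv_bound (L * (2 * c) * \<bar>t - s\<bar>) (T (M s)) (T (M t))" if "0 \<le> s" "0 \<le> t" for s t
    using T_lipschitz[OF P P curvesD(2)[OF M]] that by (simp add: mult.assoc)
  then show "continuous_on {0..} (\<lambda>t. \<integral>x. f x \<partial>T (M t))"
    by (rule continuous_on_expectation[OF _ _ _ f])
       (use c_pos L_nonneg prob_algebraD(2)[OF T_space[OF P]] in auto)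
qed

lemma driven_exists:
  assumes N: "N \<in> curves" and M0: "M0 \<in> \<P>"
  shows "\<exists>M \<in> curves. M 0 = M0 \<and> driven M N"
proof -
  from relaxation_exists[OF c_pos M0, of "\<lambda>s. T (N s)"]
  obtain M where "\<And>t. 0 \<le> t \<Longrightarrow> M t \<in> \<P>" "M 0 = M0" "driven M N"
    unfolding driven_def using T_space[OF curvesD(1)[OF N]] curves_continuous(2)[OF N] by blast
  with driven_curves[of M N] curvesD(1)[OF N] show ?thesis by blast
qed

text \<open>Each test function yields a scalar equation for the difference of expectations, starting
  at 0 by the common initial law. \<open>T_lipschitz\<close> bounds its forcing, and
  \<open>exp_comparison\<close> applies with \<open>B * d\<close> in place of
  \<open>d\<close>.\<close>

lemma driven_contraction:
  assumes M: "M \<in> curves" "M' \<in> curves" and N: "N \<in> curves" "N' \<in> curves"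
    and dr: "driven M N" "driven M' N'" and 0: "M 0 = M' 0" and "0 \<le> d"
    and tv: "\<And>s. 0 \<le> s \<Longrightarrow> tv_bound (d * exp (c * L * s)) (N s) (N' s)" and t: "0 \<le> t"
  shows "tv_bound (q * d * exp (c * L * t)) (M t) (M' t)"
  unfolding tv_bound_def
proof (intro allI impI)
  fix f :: "'s \<Rightarrow> real" and B assume f': "f \<in> borel_measurable (M t)" and B': "\<forall>x. \<bar>f x\<bar> \<le> B"
  then have B: "\<bar>f x\<bar> \<le> B" for x by blast
  have "0 \<le> B" using B[of undefined] by linarith
  have f: "f \<in> borel_measurable borel"
    using f' prob_algebraD[OF curvesD(1)[OF M(1) t]] by (simp cong: measurable_cong_sets)
  have "\<bar>(\<integral>x. f x \<partial>M t) - (\<integral>x. f x \<partial>M' t)\<bar> \<le> L / (L + 1) * (B * d) * exp (c * L * t)"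
  proof (rule exp_comparison[where w = "\<lambda>s. (\<integral>x. f x \<partial>T (N s)) - (\<integral>x. f x \<partial>T (N' s))"])
    fix s :: real assume s: "0 \<le> s"
    show "((\<lambda>s. (\<integral>x. f x \<partial>M s) - (\<integral>x. f x \<partial>M' s)) has_real_derivative
        c * ((\<integral>x. f x \<partial>T (N s)) - (\<integral>x. f x \<partial>T (N' s)) - ((\<integral>x. f x \<partial>M s) - (\<integral>x. f x \<partial>M' s))))
        (at s within {0..})"
      using DERIV_diff[OF drivenD[OF dr(1) f B s] drivenD[OF dr(2) f B s]]
      by (simp add: algebra_simps)
    have NP: "N s \<in> \<P>" "N' s \<in> \<P>" using N s curvesD by blast+
    have "f \<in> borel_measurable (T (N s))"
      using f prob_algebraD[OF T_space[OF NP(1)]] by (simp cong: measurable_cong_sets)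
    from tv_boundD[OF T_lipschitz[OF NP tv[OF s]] this B]
    show "\<bar>(\<integral>x. f x \<partial>T (N s)) - (\<integral>x. f x \<partial>T (N' s))\<bar> \<le> L * (B * d) * exp (c * L * s)"
      by (simp add: mult_ac)
  qed (use c_pos L_nonneg \<open>0 \<le> B\<close> \<open>0 \<le> d\<close> t 0 in auto)
  then show "\<bar>(\<integral>x. f x \<partial>M t) - (\<integral>x. f x \<partial>M' t)\<bar> \<le> B * (q * d * exp (c * L * t))"
    by (simp add: q_def mult_ac)
qed

section \<open>Fixed points of the Picard step\<close>

lemma q_power_LIMSEQ: "(\<lambda>n. C * q ^ n * E) \<longlonglongrightarrow> 0"
proof -
  have "(\<lambda>n. C * q ^ n * E) \<longlonglongrightarrow> C * 0 * E"
    by (intro tendsto_intros LIMSEQ_realpow_zero q)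
  then show ?thesis by simp
qed

text \<open>Both curves are fixed points, so the contraction can be applied to the same pair again
  and again, starting from the trivial distance 2. The bound is carried for all times together,
  since one step uses it at every time.\<close>

lemma driven_self_unique:
  assumes M: "M \<in> curves" "M' \<in> curves" and dr: "driven M M" "driven M' M'" and 0: "M 0 = M' 0"
    and t: "0 \<le> t"
  shows "M t = M' t"
proof -
  have P: "M t \<in> \<P>" "M' t \<in> \<P>" if "0 \<le> t" for t using M that curvesD by blast+
  have "tv_bound (2 * q ^ n * exp (c * L * t)) (M t) (M' t)" if "0 \<le> t" for n t
    using that
  proof (induction n arbitrary: t)
    case 0
    \<comment> \<open>The weight is at least 1, so the trivial bound 2 may be multiplied by
      it.\<close>
    have "1 \<le> exp (c * L * t)" using 0 c_pos L_nonneg by simp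
    then show ?case
      using P[OF 0] prob_algebraD by (intro tv_bound_mono[OF tv_bound_2]) auto
  next
    case (Suc n)
    from driven_contraction[OF M M dr \<open>M 0 = M' 0\<close> _ Suc.IH Suc.prems] q
    show ?case by (simp add: mult_ac)
  qed
  from tv_bound_LIMSEQ[OF this[OF t] q_power_LIMSEQ] show ?thesis
    using P[OF t] by (intro tv_bound_0_eq) (auto dest: prob_algebraD)
qed

lemma driven_self_exists:
  assumes M0: "M0 \<in> \<P>"
  shows "\<exists>M \<in> curves. M 0 = M0 \<and> driven M M"
proof -
  have "(\<lambda>_. M0) \<in> curves"
    using M0 c_pos by (auto simp: curves_def tv_bound_def intro!: mult_nonneg_nonneg intro: order_trans[OF abs_ge_zero])
  moreover from driven_exists[OF _ M0] obtain \<Phi> where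
    \<Phi>: "\<And>N. N \<in> curves \<Longrightarrow> \<Phi> N \<in> curves \<and> \<Phi> N 0 = M0 \<and> driven (\<Phi> N) N"
    by metis
  \<comment> \<open>The iteration starts from the curve that rests at \<open>M0\<close>; every
    iterate has the initial law \<open>M0\<close>, as the contraction demands.\<close>
  define P where "P n = (\<Phi> ^^ n) (\<lambda>_. M0)" for n
  ultimately have P: "P n \<in> curves" for n
    by (induction n) (auto simp: P_def \<Phi>)
  have P_Suc: "driven (P (Suc n)) (P n)" "P n 0 = M0" for n
    using \<Phi>[OF P[of n]] \<Phi>[OF P[of "n - 1"]] by (auto simp: P_def) (cases n; simp)
  have prob: "prob_space (P n t)" "sets (P n t) = sets borel" "P n t \<in> \<P>" if "0 \<le> t" for n t
    using curvesD(1)[OF P that] prob_algebraD by blast+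
  have diff1: "tv_bound (2 * q ^ n * exp (c * L * t)) (P n t) (P (Suc n) t)" if "0 \<le> t" for n t
    using that
  proof (induction n arbitrary: t)
    case 0
    have "1 \<le> exp (c * L * t)" using 0 c_pos L_nonneg by simp
    then show ?case
      using prob[OF 0] by (intro tv_bound_mono[OF tv_bound_2]) auto
  next
    case (Suc n)
    from driven_contraction[OF P P P P P_Suc(1) P_Suc(1) _ _ Suc.IH Suc.prems] q P_Suc(2)
    show ?case by (simp add: mult_ac)
  qed
  \<comment> \<open>The tail of the geometric series with terms 2 q^n: the factor
    \<open>L + 1\<close> is 1 / (1 - q). The induction below sums from \<open>n\<close> to
    \<open>m\<close>, with q^n - q^m in place of q^n.\<close>
  define e where "e t n = 2 * (L + 1) * q ^ n * exp (c * L * t)" for t n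
  have e: "e t \<longlonglongrightarrow> 0" for t unfolding e_def by (rule q_power_LIMSEQ)
  have cauchy: "tv_bound (e t n) (P n t) (P m t)" if t: "0 \<le> t" and "n \<le> m" for t n m
  proof -
    have "tv_bound (2 * (L + 1) * (q ^ n - q ^ m) * exp (c * L * t)) (P n t) (P m t)"
      using \<open>n \<le> m\<close>
    proof (induction m rule: dec_induct)
      case base
      then show ?case by (simp add: tv_bound_def)
    next
      case (step m)
      have "2 * (L + 1) * (q ^ n - q ^ m) * exp (c * L * t) + 2 * q ^ m * exp (c * L * t) =
          2 * ((L + 1) * q ^ n - L * q ^ m) * exp (c * L * t)"
        by (simp add: algebra_simps)
      also have "L * q ^ m = (L + 1) * q ^ Suc m" using q(3) by (simp add: mult.assoc[symmetric])
      also have "2 * ((L + 1) * q ^ n - (L + 1) * q ^ Suc m) * exp (c * L * t) =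
          2 * (L + 1) * (q ^ n - q ^ Suc m) * exp (c * L * t)"
        by (simp add: algebra_simps)
      finally show ?case
        using tv_bound_triangle[OF step.IH diff1[OF t]] prob[OF t] by simp
    qed
    moreover have "2 * (L + 1) * (q ^ n - q ^ m) * exp (c * L * t) \<le> e t n"
      unfolding e_def using q L_nonneg by (intro mult_right_mono mult_left_mono) auto
    ultimately show ?thesis by (rule tv_bound_mono)
  qed
  \<comment> \<open>The limit is taken separately at each time; the weight enters only as a constant
    factor in the rate.\<close>
  have "\<exists>N \<in> \<P>. \<forall>n. tv_bound (e t n) (P n t) N" if "0 \<le> t" for t
    using prob[OF that] cauchy[OF that] e by (intro tv_Cauchy_limit) auto
  then obtain N where N: "\<And>t. 0 \<le> t \<Longrightarrow> N t \<in> \<P>"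
    and lim: "\<And>t n. 0 \<le> t \<Longrightarrow> tv_bound (e t n) (P n t) (N t)"
    by metis
  have N_sets: "sets (N t) = sets borel" if "0 \<le> t" for t using N[OF that] prob_algebraD by blast
  \<comment> \<open>The Lipschitz bound passes from \<open>P n\<close> to the limit, with errors
    \<open>e s n\<close> and \<open>e t n\<close> that vanish. It allows \<open>N\<close> to drive a
    further step.\<close>
  have N_curves: "N \<in> curves"
    unfolding curves_def
  proof (intro CollectI conjI allI impI N)
    fix s t :: real assume st: "0 \<le> s" "0 \<le> t"
    have "tv_bound (e s n + (2 * c * \<bar>t - s\<bar> + e t n)) (N s) (N t)" for n
      by (intro tv_bound_triangle[of _ _ "P n s"] tv_bound_triangle[of _ _ "P n t"]
          tv_bound_sym[OF lim] lim curvesD(2)[OF P]) (use st prob N_sets in auto)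
    moreover have "(\<lambda>n. e s n + (2 * c * \<bar>t - s\<bar> + e t n)) \<longlonglongrightarrow> 0 + (2 * c * \<bar>t - s\<bar> + 0)"
      by (intro tendsto_intros e)
    ultimately have "tv_bound (0 + (2 * c * \<bar>t - s\<bar> + 0)) (N s) (N t)" by (rule tv_bound_LIMSEQ)
    then show "tv_bound (2 * c * \<bar>t - s\<bar>) (N s) (N t)" by simp
  qed
  \<comment> \<open>No differential equation is passed to the limit. One more step is taken from
    \<open>N\<close> to \<open>M\<close>; the contraction turns closeness of \<open>P n\<close> to
    \<open>N\<close> into closeness of \<open>P (Suc n)\<close> to \<open>M\<close>, so the iterates
    converge to both and \<open>M\<close> equals \<open>N\<close>.\<close>
  from driven_exists[OF this M0] obtain M where M: "M \<in> curves" "M 0 = M0" "driven M N" by blast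
  have "M t = N t" if t: "0 \<le> t" for t
  proof -
    have "tv_bound (e t (Suc n)) (P (Suc n) t) (M t)" for n
    proof -
      have "tv_bound (q * (2 * (L + 1) * q ^ n) * exp (c * L * t)) (P (Suc n) t) (M t)"
        by (rule driven_contraction[OF P M(1) P N_curves P_Suc(1) M(3) _ _ _ t])
           (use P_Suc(2) M(2) q L_nonneg lim in \<open>auto simp: e_def\<close>)
      then show ?thesis by (simp add: e_def mult_ac)
    qed
    from tv_bound_triangle[OF tv_bound_sym[OF this] lim[OF t]]
    have "tv_bound (e t (Suc n) + e t (Suc n)) (M t) (N t)" for n
      using prob(2)[OF t] prob_algebraD(2)[OF curvesD(1)[OF M(1) t]] by simp
    moreover have "(\<lambda>n. e t (Suc n) + e t (Suc n)) \<longlonglongrightarrow> 0 + 0"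
      by (intro tendsto_intros LIMSEQ_Suc e)
    ultimately have "tv_bound (0 + 0) (M t) (N t)" by (rule tv_bound_LIMSEQ)
    then show ?thesis
      using N[OF t] curvesD(1)[OF M(1) t] by (intro tv_bound_0_eq) (auto dest: prob_algebraD)
  qed
  \<comment> \<open>\<open>driven\<close> reads the driving curve at nonnegative times only, where
    \<open>M\<close> and \<open>N\<close> agree.\<close>
  with M(3) have "driven M M" by (simp add: driven_def)
  with M show ?thesis by blast
qed

text \<open>From left to right, membership in \<open>curves\<close> is a consequence of the
  equation. From right to left, it supplies the continuity of the derivative, through
  \<open>curves_continuous\<close>.\<close>

lemma mean_field_solution_iff:
  "mean_field_solution r \<gamma> M \<longleftrightarrow> M \<in> extensional {0..} \<and> M \<in> curves \<and> driven M M"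
proof
  assume sol: "mean_field_solution r \<gamma> M"
  then have P: "M t \<in> \<P>" if "0 \<le> t" for t
    using that by (auto simp: mean_field_solution_def)
  have "driven M M"
    unfolding driven_def
  proof (intro allI impI)
    fix f :: "'s \<Rightarrow> real" and B t assume f: "f \<in> borel_measurable borel" "\<forall>x. \<bar>f x\<bar> \<le> B" "(0::real) \<le> t"
    then have "bounded (range f)" by (auto simp: bounded_iff)
    with sol f show "((\<lambda>s. \<integral>x. f x \<partial>M s) has_real_derivative c * ((\<integral>x. f x \<partial>T (M t)) - (\<integral>x. f x \<partial>M t)))
        (at t within {0..})"
      unfolding mean_field_solution_def c_def by metis
  qed
  with driven_curves[OF P P] sol show "M \<in> extensional {0..} \<and> M \<in> curves \<and> driven M M"
    by (auto simp: mean_field_solution_def PiE_def)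
next
  assume M: "M \<in> extensional {0..} \<and> M \<in> curves \<and> driven M M"
  show "mean_field_solution r \<gamma> M"
    unfolding mean_field_solution_def
  proof (intro conjI allI impI)
    show "M \<in> {0..} \<rightarrow>\<^sub>E \<P>" using M curvesD by (auto simp: PiE_def)
    fix f :: "'s \<Rightarrow> real" assume f: "f \<in> borel_measurable borel \<and> bounded (range f)"
    then obtain B where B: "\<And>x. \<bar>f x\<bar> \<le> B" by (auto simp: bounded_iff)
    show "\<exists>D. continuous_on {0..} D \<and>
         (\<forall>t\<ge>0. ((\<lambda>s. \<integral>x. f x \<partial>M s) has_real_derivative D t) (at t within {0..}) \<and>
           D t = total_mass r * ((\<integral>x. f x \<partial>T (M t)) - (\<integral>x. f x \<partial>M t)))"
      using M f B
      by (intro exI[of _ "\<lambda>t. c * ((\<integral>x. f x \<partial>T (M t)) - (\<integral>x. f x \<partial>M t))"])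
         (auto intro!: continuous_intros curves_continuous drivenD simp: c_def[symmetric])
  qed
qed

lemma solution_exists_unique:
  assumes M0: "M0 \<in> \<P>"
  shows "\<exists>!M. mean_field_solution r \<gamma> M \<and> M 0 = M0"
proof (rule ex_ex1I)
  from driven_self_exists[OF M0] obtain M where M: "M \<in> curves" "M 0 = M0" "driven M M" by blast
  \<comment> \<open>The constructed curve has arbitrary values at negative times, whereas a family
    must be \<open>undefined\<close> there. Derivatives within \<open>{0..}\<close> do not notice
    the change.\<close>
  let ?M = "restrict M {0..}"
  have "?M \<in> curves" using M(1) by (auto simp: curves_def)
  moreover have "driven ?M ?M"
    unfolding driven_def
  proof (intro allI impI)
    fix f :: "'s \<Rightarrow> real" and B t assume f: "f \<in> borel_measurable borel" "\<forall>x. \<bar>f x\<bar> \<le> B" "(0::real) \<le> t"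
    have "((\<lambda>s. \<integral>x. f x \<partial>?M s) has_real_derivative c * ((\<integral>x. f x \<partial>T (M t)) - (\<integral>x. f x \<partial>M t))) (at t within {0..})"
      by (rule has_field_derivative_transform_within[OF drivenD[OF M(3) f(1) _ f(3)], of B 1])
         (use f in auto)
    with f(3) show "((\<lambda>s. \<integral>x. f x \<partial>?M s) has_real_derivative c * ((\<integral>x. f x \<partial>T (?M t)) - (\<integral>x. f x \<partial>?M t))) (at t within {0..})"
      by simp
  qed
  ultimately show "\<exists>M. mean_field_solution r \<gamma> M \<and> M 0 = M0"
    using M(2) by (intro exI[of _ ?M]) (simp add: mean_field_solution_iff)
next
  fix M M' assume "mean_field_solution r \<gamma> M \<and> M 0 = M0" "mean_field_solution r \<gamma> M' \<and> M' 0 = M0"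
  then show "M = M'"
    using driven_self_unique[of M M'] by (intro extensionalityI[of M "{0..}"]) (auto simp: mean_field_solution_iff)
qed

end

theorem theorem1:
  fixes r :: "'w::polish_space measure"
    and \<gamma> :: "'w \<Rightarrow> (nat \<Rightarrow> 's) \<Rightarrow> 's::polish_space"
    and \<kappa> :: "'w \<Rightarrow> nat"
    and \<mu>0 :: "'s measure"
  assumes "sets r = sets borel" and "finite_measure r" and "emeasure r (space r) \<noteq> 0"
    and "(\<lambda>(\<omega>, x). \<gamma> \<omega> x) \<in> borel \<Otimes>\<^sub>M (\<Pi>\<^sub>M i\<in>UNIV. borel) \<rightarrow>\<^sub>M borel"
    and "\<kappa> \<in> borel \<rightarrow>\<^sub>M count_space UNIV"
    and "\<And>\<omega> x y. (\<And>i. i < \<kappa> \<omega> \<Longrightarrow> x i = y i) \<Longrightarrow> \<gamma> \<omega> x = \<gamma> \<omega> y"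
    and "(\<integral>\<^sup>+\<omega>. of_nat (\<kappa> \<omega>) \<partial>r) < \<infinity>"
    and "\<mu>0 \<in> space (prob_algebra borel)"
  shows "\<exists>!\<mu>. mean_field_solution r \<gamma> \<mu> \<and> \<mu> 0 = \<mu>0"
proof -
  interpret mean_field r \<gamma> \<kappa>
    by (rule mean_field.intro) fact+
  show ?thesis by (rule solution_exists_unique) fact
qed

end
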